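(* Let $\alpha\in\mathbb{R}\setminus\{0,-1\}$, let $p_1,p_2\in[1,\infty)$ with $\frac{1}{p_1}+\frac{1}{p_2}=1$, and let $f\in L^{p_1}(\mathbb{R})$, $g\in L^{p_2}(\mathbb{R})$. Let $x\in A^{p_1}_f\cap A^{p_2}_g$. Then $x\in A_{fg}$ and $$\lim_{\varepsilon\to 0^+}\Bigl\{\int_{-\infty}^{\infty}f(x-t)\,g(x+\alpha t)\,\frac{t}{t^{2}+\varepsilon^{2}}\,dt-\int_{|t|\ge\varepsilon}\frac{f(x-t)\,g(x+\alpha t)}{t}\,dt\Bigr\}=0.$$
   Context: Functions are complex-valued measurable functions on $\mathbb{R}$, defined pointwise (a representative is fixed). For $1\le p<\infty$ and $f\in L^p_{loc}(\mathbb{R})$, a point $x\in\mathbb{R}$ is a $p$-Lebesgue point of $f$, written $x\in A^p_f$, if $\frac1r\int_{|t|<r}|f(x-t)-f(x)|^p\,dt\to 0$ as $r\to 0^+$. For $p=1$ write $A_f=A^1_f$. The product $fg$ is taken pointwise. *)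

theory Defs
  imports "HOL-Analysis.Analysis"
begin

text \<open>
  Functions are honest functions \<open>real \<Rightarrow> complex\<close> (no quotient by a.e. equality), because Lebesgue
  points depend on the value of the chosen representative at the point. Measurability and
  integrals refer to the completed measure \<open>lebesgue\<close>. The exponent is a finite real \<open>p \<ge> 1\<close>.
\<close>

definition Lp :: "real \<Rightarrow> (real \<Rightarrow> complex) set" where
  "Lp p = {f. f \<in> borel_measurable lebesgue \<and> integrable lebesgue (\<lambda>t. norm (f t) powr p)}"

definition Lp_loc :: "real \<Rightarrow> (real \<Rightarrow> complex) set" where
  "Lp_loc p = {f. f \<in> borel_measurable lebesgue \<and>
     (\<forall>K. compact K \<longrightarrow> set_integrable lebesgue K (\<lambda>t. norm (f t) powr p))}"

text \<open>
  Membership in \<open>Lp_loc p\<close> is part of the definition, so that the Bochner integrals below never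
  take their default value for non-integrable functions.
\<close>

definition lebesgue_points :: "real \<Rightarrow> (real \<Rightarrow> complex) \<Rightarrow> real set" where
  "lebesgue_points p f = {x. f \<in> Lp_loc p \<and>
     ((\<lambda>r. 1 / r * (LINT t:{t. \<bar>t\<bar> < r}|lebesgue. norm (f (x - t) - f x) powr p)) \<longlongrightarrow> 0)
       (at_right 0)}"

end

(* Young's inequality turns the p1- and p2-Lebesgue conditions into the vanishing of the means
   of |H - H 0| over |t| < r, where H t = f (x - t) * g (x + \<alpha> * t). The difference of the two kernels
   is odd, hence has integral zero, so H may be replaced by H - H 0. It is dominated by the sum over k
   of (8 / \<epsilon>) * 8^-k times the indicator of |t| < 2^k * \<epsilon>, so the integral is at most the sum of
   8 * 4^-k times the mean of |H - H 0| over |t| < 2^k * \<epsilon>. These means are bounded and tend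
   to 0 for each k, and Tannery's theorem concludes. *)
theory Submission
  imports Defs
begin

section \<open>Means over symmetric intervals about the origin, under domination and
  products\<close>

definition ball_mean :: "real \<Rightarrow> (real \<Rightarrow> complex) \<Rightarrow> real \<Rightarrow> real" where
  "ball_mean p u r = 1 / r * (LINT t:{t. \<bar>t\<bar> < r}|lebesgue. norm (u t) powr p)"

text \<open>A centred form of the Lebesgue point condition: \<open>u\<close> stands for a function
  minus its value at the point, moved to the origin. Integrability on every interval is included so
  that no integral in \<open>ball_mean\<close> takes its default value.\<close>

definition vanishing_mean :: "real \<Rightarrow> (real \<Rightarrow> complex) \<Rightarrow> bool" where
  "vanishing_mean p u \<longleftrightarrow> u \<in> borel_measurable lebesgue \<and>
     (\<forall>r. set_integrable lebesgue {t. \<bar>t\<bar> < r} (\<lambda>t. norm (u t) powr p)) \<and>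
     (ball_mean p u \<longlongrightarrow> 0) (at_right 0)"

lemma abs_less_eq_ivl: "{t::real. \<bar>t\<bar> < r} = {-r<..<r}"
  by auto

lemma abs_ball_sets [measurable, simp]: "{t::real. \<bar>t\<bar> < r} \<in> sets lebesgue"
  by (simp add: abs_less_eq_ivl)

lemma set_integral_abs_ball_const:
  "0 \<le> r \<Longrightarrow> (LINT t:{t::real. \<bar>t\<bar> < r}|lebesgue. (c::real)) = 2 * r * c"
  by (simp add: abs_less_eq_ivl set_lebesgue_integral_def)

lemma set_integrable_abs_ball_const:
  "set_integrable lebesgue {t::real. \<bar>t\<bar> < r} (\<lambda>t. c::real)"
  unfolding set_integrable_def
  by (intro integrable_scaleR_left)
    (use lmeasurable_iff_integrable[of "{-r<..<r}"] in \<open>simp add: abs_less_eq_ivl\<close>)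

lemma ball_mean_nonneg: "0 \<le> r \<Longrightarrow> 0 \<le> ball_mean p u r"
  unfolding ball_mean_def set_lebesgue_integral_def
  by (intro mult_nonneg_nonneg integral_nonneg_AE) auto

text \<open>For v above \<delta>, write v as \<open>v powr (1 - p) * v powr p\<close>; the first
  factor decreases in v because 1 - p \<le> 0. This trades a linear term for a p-th power at the
  cost of an arbitrarily small constant, so means with exponent p control means with exponent 1
  without Hoelder's inequality.\<close>

lemma le_eps_plus_powr:
  fixes v :: real
  assumes "0 \<le> v" "0 < \<delta>" "1 \<le> p"
  shows "v \<le> \<delta> + \<delta> powr (1 - p) * v powr p"
proof (cases "v \<le> \<delta>")
  case True
  then show ?thesis by (simp add: add_increasing2)
next
  case False
  then have "v powr (1 - p) \<le> \<delta> powr (1 - p)"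
    using assms by (intro powr_mono2') auto
  then have "v powr (1 - p) * v powr p \<le> \<delta> powr (1 - p) * v powr p"
    by (rule mult_right_mono) simp
  moreover have "v powr (1 - p) * v powr p = v"
    using False assms by (simp flip: powr_add)
  ultimately show ?thesis using assms by simp
qed

text \<open>The constant \<delta> contributes 2 * \<delta> to the mean whatever the radius, and for
  fixed C the remaining part tends to 0 with the radius. Since \<delta> is arbitrary, the mean of
  \<open>w\<close> vanishes in the limit; C may blow up as \<delta> shrinks.\<close>

lemma vanishing_mean_dominated:
  assumes u: "vanishing_mean a u" and v: "vanishing_mean b v"
    and w[measurable]: "w \<in> borel_measurable lebesgue"
    and le: "\<And>\<delta>. 0 < \<delta> \<Longrightarrow> \<exists>C. 0 \<le> C \<and> (\<forall>t. norm (w t) \<le> \<delta> + C * (norm (u t) powr a + norm (v t) powr b))"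
  shows "vanishing_mean 1 w"
proof -
  let ?S = "\<lambda>r. {t::real. \<bar>t\<bar> < r}"
  have ui: "set_integrable lebesgue (?S r) (\<lambda>t. norm (u t) powr a)"
    and vi: "set_integrable lebesgue (?S r) (\<lambda>t. norm (v t) powr b)" for r
    using u v by (auto simp: vanishing_mean_def)
  have di: "set_integrable lebesgue (?S r) (\<lambda>t. \<delta> + C * (norm (u t) powr a + norm (v t) powr b))" for r \<delta> C
    by (intro set_integral_add set_integrable_mult_right set_integrable_abs_ball_const ui vi)
  have wi: "set_integrable lebesgue (?S r) (\<lambda>t. norm (w t))" for r
  proof -
    obtain C where C: "\<And>t. norm (w t) \<le> 1 + C * (norm (u t) powr a + norm (v t) powr b)"
      using le[of 1] by auto
    show ?thesis
      by (rule set_integrable_bound[OF di[of r 1 C]])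
        (use C in \<open>auto simp: set_borel_measurable_def intro!: AE_I2 order.trans[OF C]\<close>)
  qed
  have "(ball_mean 1 w \<longlongrightarrow> 0) (at_right 0)"
  proof (rule tendstoI)
    fix e :: real assume e: "0 < e"
    \<comment> \<open>Means are normalised by 1 / r on an interval of length 2 * r, so the constant
      e / 4 costs e / 2 and leaves e / 2 for the vanishing part.\<close>
    obtain C where C0: "0 \<le> C"
      and C: "\<And>t. norm (w t) \<le> e / 4 + C * (norm (u t) powr a + norm (v t) powr b)"
      using le[of "e / 4"] e by auto
    have bound: "ball_mean 1 w r \<le> e / 2 + C * (ball_mean a u r + ball_mean b v r)" if "0 < r" for r
    proof -
      have "(LINT t:?S r|lebesgue. norm (w t)) 
          \<le> (LINT t:?S r|lebesgue. e / 4 + C * (norm (u t) powr a + norm (v t) powr b))"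
        by (intro set_integral_mono wi di C)
      also have "\<dots> = 2 * r * (e / 4) + C * ((LINT t:?S r|lebesgue. norm (u t) powr a)
          + (LINT t:?S r|lebesgue. norm (v t) powr b))"
        using that
        by (simp only: set_integral_add(2)[OF set_integrable_abs_ball_const
              set_integrable_mult_right[OF set_integral_add(1)[OF ui vi]]] 
            set_integral_add(2)[OF ui vi] set_integral_mult_right set_integral_abs_ball_const less_imp_le)
      finally show ?thesis
        using that by (simp add: ball_mean_def field_simps)
    qed
    have "((\<lambda>r. e / 2 + C * (ball_mean a u r + ball_mean b v r)) \<longlongrightarrow> e / 2 + C * (0 + 0)) (at_right 0)"
      using u v by (intro tendsto_intros) (auto simp: vanishing_mean_def)
    then have "\<forall>\<^sub>F r in at_right 0. e / 2 + C * (ball_mean a u r + ball_mean b v r) < e"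
      using e by (auto dest!: order_tendstoD(2)[where a = e])
    then show "\<forall>\<^sub>F r in at_right 0. dist (ball_mean 1 w r) 0 < e"
      using eventually_at_right_less[of 0]
    proof eventually_elim
      case (elim r)
      then show ?case using bound[of r] ball_mean_nonneg[of r 1 w] by (simp add: dist_real_def)
    qed
  qed
  then show ?thesis using wi by (simp add: vanishing_mean_def)
qed

text \<open>Expand around the limit values: F G - c d = (F - c) (G - d) + c (G - d) + d (F - c).
  Young's inequality bounds the first product by the two powers, and \<open>le_eps_plus_powr\<close>
  handles the two linear terms.\<close>

lemma vanishing_mean_mult:
  assumes ab: "1 < a" "1 < b" "1 / a + 1 / b = 1"
    and F: "vanishing_mean a (\<lambda>t. F t - c)" and G: "vanishing_mean b (\<lambda>t. G t - d)"
  shows "vanishing_mean 1 (\<lambda>t. F t * G t - c * d)"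
proof (rule vanishing_mean_dominated[OF F G])
  \<comment> \<open>Only the differences are known to be measurable; adding the constants back
    recovers \<open>F\<close> and \<open>G\<close>.\<close>
  have "(\<lambda>t. (F t - c) + c) \<in> borel_measurable lebesgue" "(\<lambda>t. (G t - d) + d) \<in> borel_measurable lebesgue"
    using F G unfolding vanishing_mean_def by (intro borel_measurable_add borel_measurable_const; blast)+
  then show "(\<lambda>t. F t * G t - c * d) \<in> borel_measurable lebesgue"
    by simp
next
  fix \<delta> :: real assume \<delta>: "0 < \<delta>"
  \<comment> \<open>The summand 1 keeps K positive when c and d are both 0. With \<eta> = \<delta> /
    K the constants from the two linear terms add up to at most \<delta>.\<close>
  define K where "K = norm c + norm d + 1"
  have K: "0 < K" "norm c + norm d \<le> K" by (auto simp: K_def add_nonneg_pos)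
  define \<eta> where "\<eta> = \<delta> / K"
  have \<eta>: "0 < \<eta>" using K \<delta> by (simp add: \<eta>_def)
  define C where "C = 1 + norm d * \<eta> powr (1 - a) + norm c * \<eta> powr (1 - b)"
  have "norm (F t * G t - c * d) \<le> \<delta> + C * (norm (F t - c) powr a + norm (G t - d) powr b)" for t
  proof -
    let ?u = "norm (F t - c)" and ?v = "norm (G t - d)"
    have "F t * G t - c * d = (F t - c) * (G t - d) + c * (G t - d) + d * (F t - c)"
      by (simp add: algebra_simps)
    then have "norm (F t * G t - c * d) \<le> ?u * ?v + norm c * ?v + norm d * ?u"
      by (simp only: flip: norm_mult) (meson norm_triangle_mono norm_triangle_ineq order_refl)
    also have "?u * ?v \<le> ?u powr a / a + ?v powr b / b"
      using ab by (intro Youngs_inequality) auto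
    also have "\<dots> \<le> ?u powr a + ?v powr b"
      using ab mult_right_mono[of 1 a "?u powr a"] mult_right_mono[of 1 b "?v powr b"]
      by (intro add_mono) (simp_all add: divide_le_eq mult.commute)
    also have "norm c * ?v \<le> norm c * (\<eta> + \<eta> powr (1 - b) * ?v powr b)"
      using ab \<eta> by (intro mult_left_mono le_eps_plus_powr) auto
    also have "norm d * ?u \<le> norm d * (\<eta> + \<eta> powr (1 - a) * ?u powr a)"
      using ab \<eta> by (intro mult_left_mono le_eps_plus_powr) auto
    finally have *: "norm (F t * G t - c * d) \<le> (norm c + norm d) * \<eta>
        + (?u powr a + ?v powr b + norm c * \<eta> powr (1 - b) * ?v powr b + norm d * \<eta> powr (1 - a) * ?u powr a)"
      by (simp add: algebra_simps)
    have "(norm c + norm d) * \<eta> \<le> K * \<eta>"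
      using K \<eta> by (intro mult_right_mono) auto
    also have "\<dots> = \<delta>" using K by (simp add: \<eta>_def)
    finally have "(norm c + norm d) * \<eta> \<le> \<delta>" .
    moreover have "?u powr a + ?v powr b + norm c * \<eta> powr (1 - b) * ?v powr b + norm d * \<eta> powr (1 - a) * ?u powr a
       \<le> C * (?u powr a + ?v powr b)"
      by (simp add: C_def algebra_simps)
    ultimately show ?thesis using * by linarith
  qed
  moreover have "0 \<le> C" by (simp add: C_def)
  ultimately show "\<exists>C. 0 \<le> C \<and> (\<forall>t. norm (F t * G t - c * d) \<le> \<delta> + C * (norm (F t - c) powr a + norm (G t - d) powr b))"
    by blast
qed

section \<open>Lebesgue points under affine changes of variable\<close>

lemma measurable_lebesgue_affine:
  fixes f :: "real \<Rightarrow> 'a::topological_space" and \<beta> x :: real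
  assumes "f \<in> borel_measurable lebesgue" "\<beta> \<noteq> 0"
  shows "(\<lambda>t. f (x + \<beta> * t)) \<in> borel_measurable lebesgue"
proof -
  have "(\<lambda>t. x + \<beta> * t) \<in> lebesgue \<rightarrow>\<^sub>M lebesgue"
    using lebesgue_affine_measurable[of "\<lambda>_. \<beta>" x] assms by simp
  from measurable_compose[OF this assms(1)] show ?thesis .
qed

text \<open>Since norm (f t - c) is at most twice the larger of norm (f t) and norm c, its p-th
  power is dominated by the two separate powers, and the constant one is integrable on a bounded
  interval.\<close>

lemma set_integrable_norm_diff_powr:
  fixes f :: "real \<Rightarrow> complex"
  assumes f[measurable]: "f \<in> borel_measurable lebesgue" and p: "0 \<le> p"
    and i: "integrable lebesgue (\<lambda>t. norm (f t) powr p)"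
  shows "set_integrable lebesgue {t. \<bar>t\<bar> < r} (\<lambda>t. norm (f t - c) powr p)"
proof (rule set_integrable_bound)
  show "set_integrable lebesgue {t. \<bar>t\<bar> < r} (\<lambda>t. 2 powr p * (norm (f t) powr p + norm c powr p))"
  proof (intro set_integrable_mult_right set_integral_add)
    show "set_integrable lebesgue {t. \<bar>t\<bar> < r} (\<lambda>t. norm (f t) powr p)"
      unfolding set_integrable_def using i by (intro integrable_mult_indicator) auto
  qed (rule set_integrable_abs_ball_const)
  have "norm (f t - c) powr p \<le> 2 powr p * (norm (f t) powr p + norm c powr p)" for t
  proof -
    have "norm (f t - c) powr p \<le> (2 * max (norm (f t)) (norm c)) powr p"
      using p norm_triangle_ineq4[of "f t" c] by (intro powr_mono2) auto
    also have "\<dots> = 2 powr p * max (norm (f t)) (norm c) powr p"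
      by (simp add: powr_mult)
    also have "\<dots> \<le> 2 powr p * (norm (f t) powr p + norm c powr p)"
      by (intro mult_left_mono) (auto simp: max_def)
    finally show ?thesis .
  qed
  then show "AE t in lebesgue. t \<in> {t. \<bar>t\<bar> < r} \<longrightarrow> norm (norm (f t - c) powr p)
      \<le> norm (2 powr p * (norm (f t) powr p + norm c powr p))"
    by (simp add: abs_mult)
  show "set_borel_measurable lebesgue {t. \<bar>t\<bar> < r} (\<lambda>t. norm (f t - c) powr p)"
    unfolding set_borel_measurable_def by measurable
qed

text \<open>Means over symmetric intervals see a dilation or reflection only through the radius: the
  mean of radius r of the function scaled by \<beta> is the mean of radius \<bar>\<beta>\<bar> * r
  of f (x - t) - f x. This covers both f (x - t) and g (x + \<alpha> t).\<close>

lemma lebesgue_points_imp_vanishing_mean: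
  assumes p: "1 \<le> p" and f: "f \<in> Lp p" and x: "x \<in> lebesgue_points p f" and \<beta>: "\<beta> \<noteq> 0"
  shows "vanishing_mean p (\<lambda>t. f (x + \<beta> * t) - f x)"
proof -
  have meas: "f \<in> borel_measurable lebesgue" and int: "integrable lebesgue (\<lambda>t. norm (f t) powr p)"
    using f by (auto simp: Lp_def)
  have "integrable lebesgue (\<lambda>t. norm (f (x + \<beta> * t)) powr p)"
    using int \<beta> lebesgue_integrable_real_affine[of "\<lambda>t. norm (f t) powr p" \<beta> x] by simp
  then have "set_integrable lebesgue {t. \<bar>t\<bar> < r} (\<lambda>t. norm (f (x + \<beta> * t) - f x) powr p)" for r
    using p \<beta> meas by (intro set_integrable_norm_diff_powr measurable_lebesgue_affine) auto
  moreover have "(\<lambda>t. f (x + \<beta> * t) - f x) \<in> borel_measurable lebesgue"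
    using measurable_lebesgue_affine[OF meas \<beta>] by measurable
  moreover have "(ball_mean p (\<lambda>t. f (x + \<beta> * t) - f x) \<longlongrightarrow> 0) (at_right 0)"
  proof -
    let ?m = "ball_mean p (\<lambda>t. f (x - t) - f x)"
    have eq: "ball_mean p (\<lambda>t. f (x + \<beta> * t) - f x) r = ?m (\<bar>\<beta>\<bar> * r)" for r
    proof -
      \<comment> \<open>Substituting - \<beta> t for t turns x - t into x + \<beta> t. The Jacobian
        \<bar>\<beta>\<bar> then cancels against the normalisation of the mean.\<close>
      have "(LINT t:{t. \<bar>t\<bar> < \<bar>\<beta>\<bar> * r}|lebesgue. norm (f (x - t) - f x) powr p)
        = \<bar>\<beta>\<bar> * (LINT t:{t. \<bar>t\<bar> < r}|lebesgue. norm (f (x + \<beta> * t) - f x) powr p)"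
        unfolding set_lebesgue_integral_def
        by (subst lebesgue_integral_real_affine[of "- \<beta>" _ 0])
          (use \<beta> in \<open>auto simp: indicator_def abs_mult mult_less_cancel_left_pos intro!: Bochner_Integration.integral_cong\<close>)
      then show ?thesis using \<beta> by (simp add: ball_mean_def field_simps)
    qed
    have "(?m \<longlongrightarrow> 0) (at_right 0)"
      using x unfolding lebesgue_points_def ball_mean_def by blast
    moreover have "LIM r at_right 0. \<bar>\<beta>\<bar> * r :> at_right 0"
      using \<beta> by (auto simp: filterlim_at intro!: tendsto_eq_intros eventually_at_right_less eventually_mono[OF eventually_at_right_less])
    ultimately show ?thesis
      unfolding eq by (rule filterlim_compose)
  qed
  ultimately show ?thesis by (simp add: vanishing_mean_def)
qed

section \<open>The difference of the two kernels and integration against it\<close>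

definition kernel_diff :: "real \<Rightarrow> real \<Rightarrow> real" where
  "kernel_diff \<epsilon> t = t / (t\<^sup>2 + \<epsilon>\<^sup>2) - indicator {t. \<epsilon> \<le> \<bar>t\<bar>} t / t"

lemma kernel_diff_measurable [measurable]: "kernel_diff \<epsilon> \<in> borel_measurable lebesgue"
proof -
  have "kernel_diff \<epsilon> \<in> borel_measurable borel"
    unfolding kernel_diff_def by measurable
  then show ?thesis by (simp add: measurable_completion)
qed

lemma kernel_diff_minus: "kernel_diff \<epsilon> (- t) = - kernel_diff \<epsilon> t"
  by (simp add: kernel_diff_def indicator_def)

text \<open>Inside the cut only the smooth kernel is present, and it is at most 1 / \<epsilon>.
  Outside, the leading 1 / t cancels and the size is at most \<epsilon>^2 / \<bar>t\<bar>^3; this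
  cubic decay gives the factor 8 per dyadic step.\<close>

lemma kernel_diff_dyadic_bound:
  assumes \<epsilon>: "0 < \<epsilon>"
  obtains k :: nat where "\<bar>kernel_diff \<epsilon> t\<bar> \<le> 8 / \<epsilon> * (1 / 8) ^ k" "\<bar>t\<bar> < 2 ^ k * \<epsilon>"
proof (cases "\<bar>t\<bar> < \<epsilon>")
  case True
  have "\<bar>kernel_diff \<epsilon> t\<bar> = \<bar>t\<bar> / (t\<^sup>2 + \<epsilon>\<^sup>2)"
    using True by (simp add: kernel_diff_def indicator_def abs_divide)
  also have "\<dots> \<le> \<epsilon> / \<epsilon>\<^sup>2"
    using True \<epsilon> by (intro frac_le) auto
  also have "\<dots> = 1 / \<epsilon>" by (simp add: power2_eq_square)
  also have "\<dots> \<le> 8 / \<epsilon> * (1 / 8) ^ 0" using \<epsilon> by (simp add: divide_right_mono)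
  finally show ?thesis using that[of 0] True by simp
next
  case False
  obtain n where "\<bar>t\<bar> / \<epsilon> < 2 ^ n"
    using real_arch_pow[of 2 "\<bar>t\<bar> / \<epsilon>"] by auto
  then have ex: "\<exists>n::nat. \<bar>t\<bar> < 2 ^ n * \<epsilon>" using \<epsilon> by (auto simp: field_simps)
  \<comment> \<open>Minimality of k gives 2^(k - 1) * \<epsilon> \<le> \<bar>t\<bar>. The index
    shift costs 2^3, which is the 8 in 8 / \<epsilon>.\<close>
  define k where "k = (LEAST n::nat. \<bar>t\<bar> < 2 ^ n * \<epsilon>)"
  have k: "\<bar>t\<bar> < 2 ^ k * \<epsilon>" unfolding k_def using ex by (rule LeastI_ex)
  then have "k \<noteq> 0" using False by (intro notI) simp
  then obtain j where j: "k = Suc j" by (cases k) auto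
  have jt: "2 ^ j * \<epsilon> \<le> \<bar>t\<bar>"
    using not_less_Least[of j "\<lambda>n. \<bar>t\<bar> < 2 ^ n * \<epsilon>"] j by (simp add: k_def)
  have t0: "t \<noteq> 0" "0 < \<bar>t\<bar>" using False \<epsilon> by auto
  have "t\<^sup>2 + \<epsilon>\<^sup>2 \<noteq> 0" using \<epsilon> by (simp add: sum_power2_eq_zero_iff)
  then have "kernel_diff \<epsilon> t = - (\<epsilon>\<^sup>2 / (t * (t\<^sup>2 + \<epsilon>\<^sup>2)))"
    using False t0 by (simp add: kernel_diff_def indicator_def field_simps power2_eq_square)
  then have "\<bar>kernel_diff \<epsilon> t\<bar> = \<epsilon>\<^sup>2 / (\<bar>t\<bar> * (t\<^sup>2 + \<epsilon>\<^sup>2))"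
    by (simp add: abs_mult)
  also have "\<dots> \<le> \<epsilon>\<^sup>2 / \<bar>t\<bar> ^ 3"
  proof (rule divide_left_mono)
    have "\<bar>t\<bar> ^ 3 = \<bar>t\<bar> * t\<^sup>2" by (simp add: power3_eq_cube power2_eq_square mult.assoc)
    also have "\<dots> \<le> \<bar>t\<bar> * (t\<^sup>2 + \<epsilon>\<^sup>2)" by (intro mult_left_mono) auto
    finally show "\<bar>t\<bar> ^ 3 \<le> \<bar>t\<bar> * (t\<^sup>2 + \<epsilon>\<^sup>2)" .
    show "0 < \<bar>t\<bar> * (t\<^sup>2 + \<epsilon>\<^sup>2) * \<bar>t\<bar> ^ 3"
      using t0 by (intro mult_pos_pos add_pos_nonneg) auto
  qed simp
  also have "\<dots> \<le> \<epsilon>\<^sup>2 / (2 ^ j * \<epsilon>) ^ 3"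
    using jt \<epsilon> t0 by (intro divide_left_mono power_mono mult_pos_pos) auto
  also have "\<dots> = 8 / \<epsilon> * (1 / 8) ^ k"
  proof -
    have "((2::real) ^ j) ^ 3 = (2 ^ 3) ^ j" by (simp only: mult.commute flip: power_mult)
    then have "(2 ^ j * \<epsilon>) ^ 3 = 8 ^ j * \<epsilon> ^ 3" by (simp add: power_mult_distrib)
    then show ?thesis using \<epsilon> by (simp add: j power_divide power2_eq_square power3_eq_cube)
  qed
  finally show ?thesis using that k by blast
qed

text \<open>The dyadic bound puts the integrand below a series of multiples of indicators, which is
  integrated term by term. Bounded means make the resulting series converge, so one estimate yields
  both integrability and the norm bound.\<close>

lemma
  fixes w :: "real \<Rightarrow> complex"
  assumes w[measurable]: "w \<in> borel_measurable lebesgue"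
    and wi: "\<And>r. set_integrable lebesgue {t. \<bar>t\<bar> < r} (\<lambda>t. norm (w t))"
    and C: "\<And>r. 0 < r \<Longrightarrow> ball_mean 1 w r \<le> C" and \<epsilon>: "0 < \<epsilon>"
  shows integrable_mult_kernel_diff: "integrable lebesgue (\<lambda>t. w t * of_real (kernel_diff \<epsilon> t))"
    and norm_integral_mult_kernel_diff_le:
      "norm (LINT t|lebesgue. w t * of_real (kernel_diff \<epsilon> t)) \<le> (\<Sum>k. 8 * (1 / 4) ^ k * ball_mean 1 w (2 ^ k * \<epsilon>))"
proof -
  let ?S = "\<lambda>k::nat. {t::real. \<bar>t\<bar> < 2 ^ k * \<epsilon>}"
  let ?a = "\<lambda>k. 8 * (1 / 4) ^ k * ball_mean 1 w (2 ^ k * \<epsilon>)"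
  have a0: "0 \<le> ?a k" for k
    using \<epsilon> by (intro mult_nonneg_nonneg ball_mean_nonneg) auto
  have sm: "summable ?a"
  proof (rule summable_comparison_test')
    show "summable (\<lambda>k. 8 * (1 / 4) ^ k * C)"
      by (intro summable_mult2 summable_mult summable_geometric) simp
    show "norm (?a k) \<le> 8 * (1 / 4) ^ k * C" for k
      using a0[of k] C[of "2 ^ k * \<epsilon>"] \<epsilon> by simp
  qed
  \<comment> \<open>Nonnegative integrals presuppose no integrability; it is read off afterwards
    from the finiteness of the bound.\<close>
  have "(\<integral>\<^sup>+t. norm (w t * of_real (kernel_diff \<epsilon> t)) \<partial>lebesgue)
      \<le> (\<integral>\<^sup>+t. (\<Sum>k. ennreal (8 / \<epsilon> * (1 / 8) ^ k * (indicator (?S k) t * norm (w t)))) \<partial>lebesgue)"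
  proof (rule nn_integral_mono)
    fix t
    obtain k where k: "\<bar>kernel_diff \<epsilon> t\<bar> \<le> 8 / \<epsilon> * (1 / 8) ^ k" "\<bar>t\<bar> < 2 ^ k * \<epsilon>"
      using kernel_diff_dyadic_bound[OF \<epsilon>] .
    let ?b = "\<lambda>k. ennreal (8 / \<epsilon> * (1 / 8) ^ k * (indicator (?S k) t * norm (w t)))"
    have "norm (w t * of_real (kernel_diff \<epsilon> t)) \<le> 8 / \<epsilon> * (1 / 8) ^ k * norm (w t)"
      using mult_right_mono[OF k(1), of "norm (w t)"] by (simp add: norm_mult mult.commute)
    also have "\<dots> = 8 / \<epsilon> * (1 / 8) ^ k * (indicator (?S k) t * norm (w t))"
      using k(2) by simp
    finally have "ennreal (norm (w t * of_real (kernel_diff \<epsilon> t))) \<le> ?b k"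
      by (rule ennreal_leI)
    \<comment> \<open>The index k depends on t, so its single term is bounded by the whole
      nonnegative series.\<close>
    also have "\<dots> \<le> (\<Sum>k. ?b k)"
      using sum_le_suminf[of ?b "{k}"] by simp
    finally show "ennreal (norm (w t * of_real (kernel_diff \<epsilon> t))) \<le> (\<Sum>k. ?b k)" .
  qed
  also have "\<dots> = (\<Sum>k. \<integral>\<^sup>+t. ennreal (8 / \<epsilon> * (1 / 8) ^ k * (indicator (?S k) t * norm (w t))) \<partial>lebesgue)"
    by (rule nn_integral_suminf) measurable
  also have "\<dots> = (\<Sum>k. ennreal (?a k))"
  proof (rule suminf_cong)
    fix k
    have "integrable lebesgue (\<lambda>t. 8 / \<epsilon> * (1 / 8) ^ k * (indicator (?S k) t * norm (w t)))"
      using wi[of "2 ^ k * \<epsilon>"] by (intro integrable_mult_right) (simp add: set_integrable_def)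
    then have "(\<integral>\<^sup>+t. ennreal (8 / \<epsilon> * (1 / 8) ^ k * (indicator (?S k) t * norm (w t))) \<partial>lebesgue)
        = ennreal (8 / \<epsilon> * (1 / 8) ^ k * (LINT t:?S k|lebesgue. norm (w t)))"
      using \<epsilon> by (subst nn_integral_eq_integral) (auto simp: set_lebesgue_integral_def)
    \<comment> \<open>Passing from the integral to the mean brings in the radius 2^k * \<epsilon>,
      which cancels \<epsilon> and slows the decay from 8^-k to 4^-k.\<close>
    also have "8 / \<epsilon> * (1 / 8) ^ k * (LINT t:?S k|lebesgue. norm (w t)) = ?a k"
    proof -
      have "(8::real) ^ k = 2 ^ k * 4 ^ k" by (simp flip: power_mult_distrib)
      then show ?thesis using \<epsilon> by (simp add: ball_mean_def power_divide field_simps)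
    qed
    finally show "(\<integral>\<^sup>+t. ennreal (8 / \<epsilon> * (1 / 8) ^ k * (indicator (?S k) t * norm (w t))) \<partial>lebesgue) = ennreal (?a k)" .
  qed
  also have "\<dots> = ennreal (\<Sum>k. ?a k)"
    by (rule suminf_ennreal2[OF a0 sm])
  finally have bound: "(\<integral>\<^sup>+t. norm (w t * of_real (kernel_diff \<epsilon> t)) \<partial>lebesgue) \<le> ennreal (\<Sum>k. ?a k)" .
  show int: "integrable lebesgue (\<lambda>t. w t * of_real (kernel_diff \<epsilon> t))"
  proof (rule integrableI_bounded)
    show "(\<lambda>t. w t * of_real (kernel_diff \<epsilon> t)) \<in> borel_measurable lebesgue" by measurable
    show "(\<integral>\<^sup>+t. norm (w t * of_real (kernel_diff \<epsilon> t)) \<partial>lebesgue) < \<infinity>"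
      using bound by (rule le_less_trans) simp
  qed
  have "ennreal (norm (LINT t|lebesgue. w t * of_real (kernel_diff \<epsilon> t))) \<le> ennreal (\<Sum>k. ?a k)"
    using integral_norm_bound_ennreal[OF int] bound by (rule order.trans)
  then show "norm (LINT t|lebesgue. w t * of_real (kernel_diff \<epsilon> t)) \<le> (\<Sum>k. ?a k)"
    using suminf_nonneg[OF sm a0] by simp
qed

text \<open>A constant has the same mean \<open>2 * norm c\<close> at every radius, so the preceding
  bound applies. Reflection in the origin shows that the integral equals its own negative, because
  the kernel is odd.\<close>

lemma
  fixes c :: complex
  assumes "0 < \<epsilon>"
  shows integrable_const_mult_kernel_diff: "integrable lebesgue (\<lambda>t. c * of_real (kernel_diff \<epsilon> t))"
    and integral_const_mult_kernel_diff: "(LINT t|lebesgue. c * of_real (kernel_diff \<epsilon> t)) = 0"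
proof -
  show "integrable lebesgue (\<lambda>t. c * of_real (kernel_diff \<epsilon> t))"
  proof (rule integrable_mult_kernel_diff[OF _ _ _ assms])
    show "ball_mean 1 (\<lambda>t. c) r \<le> 2 * norm c" if "0 < r" for r
      using that by (simp add: ball_mean_def set_integral_abs_ball_const)
  qed (simp_all add: set_integrable_abs_ball_const)
  have "(LINT t|lebesgue. c * complex_of_real (kernel_diff \<epsilon> t)) = - (LINT t|lebesgue. c * of_real (kernel_diff \<epsilon> t))"
    by (subst lebesgue_integral_real_affine[of "-1" _ 0]) (simp_all add: kernel_diff_minus)
  then show "(LINT t|lebesgue. c * of_real (kernel_diff \<epsilon> t)) = 0"
    by simp
qed

section \<open>The limit as \<epsilon> tends to 0\<close>

lemma vanishing_mean_bounded:
  assumes H: "integrable lebesgue H" and v: "vanishing_mean 1 (\<lambda>t. H t - h)"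
  obtains C where "\<And>r. 0 < r \<Longrightarrow> ball_mean 1 (\<lambda>t. H t - h) r \<le> C"
proof -
  let ?S = "\<lambda>r. {t::real. \<bar>t\<bar> < r}"
  \<comment> \<open>Small radii are controlled by the limit 0, radii from \<delta> on by the
    integrability of \<open>H\<close> over the whole line.\<close>
  have "\<forall>\<^sub>F r in at_right 0. ball_mean 1 (\<lambda>t. H t - h) r < 1"
    using v by (auto simp: vanishing_mean_def dest!: order_tendstoD(2)[where a = 1])
  then obtain \<delta> where \<delta>: "0 < \<delta>" and near: "\<And>r. 0 < r \<Longrightarrow> r < \<delta> \<Longrightarrow> ball_mean 1 (\<lambda>t. H t - h) r < 1"
    by (auto simp: eventually_at_right[of 0 1])
  let ?I = "LINT t|lebesgue. norm (H t)"
  have far: "ball_mean 1 (\<lambda>t. H t - h) r \<le> ?I / \<delta> + 2 * norm h" if "\<delta> \<le> r" for r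
  proof -
    have Hi: "set_integrable lebesgue (?S r) (\<lambda>t. norm (H t))"
      unfolding set_integrable_def using H by (intro integrable_mult_indicator) auto
    have "(LINT t:?S r|lebesgue. norm (H t - h)) \<le> (LINT t:?S r|lebesgue. norm (H t) + norm h)"
      using v by (intro set_integral_mono set_integral_add Hi set_integrable_abs_ball_const norm_triangle_ineq4)
        (simp add: vanishing_mean_def)
    also have "\<dots> = (LINT t:?S r|lebesgue. norm (H t)) + 2 * r * norm h"
      using that \<delta> by (simp add: set_integral_add(2)[OF Hi set_integrable_abs_ball_const] set_integral_abs_ball_const)
    also have "(LINT t:?S r|lebesgue. norm (H t)) \<le> ?I"
      unfolding set_lebesgue_integral_def using Hi H
      by (intro integral_mono) (auto simp: set_integrable_def indicator_def)
    finally have "ball_mean 1 (\<lambda>t. H t - h) r \<le> ?I / r + 2 * norm h"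
      using that \<delta> by (simp add: ball_mean_def field_simps)
    also have "?I / r \<le> ?I / \<delta>"
      using that \<delta> by (intro divide_left_mono integral_nonneg_AE) auto
    finally show ?thesis by simp
  qed
  show ?thesis
  proof (rule that)
    fix r :: real assume "0 < r"
    then show "ball_mean 1 (\<lambda>t. H t - h) r \<le> max 1 (?I / \<delta> + 2 * norm h)"
      using near[of r] far[of r] by (cases "r < \<delta>") (auto simp: max_def)
  qed
qed

text \<open>For fixed k the radius 2^k * \<epsilon> shrinks with \<epsilon>, so each term of the
  dyadic series vanishes; the uniform bound C on the means gives the summable majorant 8 * 4^-k * C
  needed to exchange limit and sum.\<close>

lemma tendsto_integral_kernel_diff:
  assumes H: "integrable lebesgue H" and v: "vanishing_mean 1 (\<lambda>t. H t - h)"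
  shows "((\<lambda>\<epsilon>. LINT t|lebesgue. H t * of_real (kernel_diff \<epsilon> t)) \<longlongrightarrow> 0) (at_right 0)"
proof -
  let ?u = "\<lambda>t. H t - h"
  obtain C where C: "\<And>r. 0 < r \<Longrightarrow> ball_mean 1 ?u r \<le> C"
    using vanishing_mean_bounded[OF H v] by blast
  let ?a = "\<lambda>k \<epsilon>. 8 * (1 / 4) ^ k * ball_mean 1 ?u (2 ^ k * \<epsilon>)"
  have um: "?u \<in> borel_measurable lebesgue"
    and ui: "set_integrable lebesgue {t. \<bar>t\<bar> < r} (\<lambda>t. norm (?u t))" for r
    using v by (auto simp: vanishing_mean_def)
  have "((\<lambda>\<epsilon>. \<Sum>k. ?a k \<epsilon>) \<longlongrightarrow> (\<Sum>k::nat. 0)) (at_right 0)"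
  proof (rule conjunct2[OF conjunct2[OF tannerys_theorem]])
    show "(?a k \<longlongrightarrow> 0) (at_right 0)" for k
    proof -
      have "LIM \<epsilon> at_right (0::real). 2 ^ k * \<epsilon> :> at_right 0"
        by (auto simp: filterlim_at intro!: tendsto_eq_intros eventually_mono[OF eventually_at_right_less])
      then have "((\<lambda>\<epsilon>. ball_mean 1 ?u (2 ^ k * \<epsilon>)) \<longlongrightarrow> 0) (at_right 0)"
        using v unfolding vanishing_mean_def by (blast intro: filterlim_compose)
      then show ?thesis by (rule tendsto_mult_right_zero)
    qed
    have "\<forall>\<^sub>F (k::nat, \<epsilon>::real) in at_top \<times>\<^sub>F at_right 0. 0 < \<epsilon>"
      by (simp add: eventually_prod2 eventually_at_right_less)
    then show "\<forall>\<^sub>F (k, \<epsilon>) in at_top \<times>\<^sub>F at_right 0. norm (?a k \<epsilon>) \<le> 8 * (1 / 4) ^ k * C"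
      by (rule eventually_mono) (auto simp: abs_mult ball_mean_nonneg intro!: mult_left_mono C)
    show "summable (\<lambda>k. 8 * (1 / 4) ^ k * C)"
      by (intro summable_mult2 summable_mult summable_geometric) simp
  qed simp
  then have lim: "((\<lambda>\<epsilon>. \<Sum>k. ?a k \<epsilon>) \<longlongrightarrow> 0) (at_right 0)" by simp
  have "norm (LINT t|lebesgue. H t * of_real (kernel_diff \<epsilon> t)) \<le> (\<Sum>k. ?a k \<epsilon>)" if \<epsilon>: "0 < \<epsilon>" for \<epsilon>
  proof -
    \<comment> \<open>Subtracting h is free, as a constant integrates to 0 against the odd kernel;
      only the centred function has vanishing means.\<close>
    have "(LINT t|lebesgue. H t * of_real (kernel_diff \<epsilon> t))
        = (LINT t|lebesgue. ?u t * of_real (kernel_diff \<epsilon> t) + h * of_real (kernel_diff \<epsilon> t))"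
      by (simp add: algebra_simps)
    also have "\<dots> = (LINT t|lebesgue. ?u t * of_real (kernel_diff \<epsilon> t))"
      using \<epsilon> by (subst Bochner_Integration.integral_add)
        (simp_all only: integrable_mult_kernel_diff[OF um ui C] integrable_const_mult_kernel_diff
          integral_const_mult_kernel_diff add_0_right)
    finally show ?thesis
      using norm_integral_mult_kernel_diff_le[OF um ui C \<epsilon>] by simp
  qed
  then have "\<forall>\<^sub>F \<epsilon> in at_right 0. norm (LINT t|lebesgue. H t * of_real (kernel_diff \<epsilon> t)) \<le> (\<Sum>k. ?a k \<epsilon>)"
    using eventually_at_right_less[of "0::real"] by (auto elim: eventually_mono)
  then show ?thesis
    using lim by (rule Lim_null_comparison)
qed

section \<open>Separating the two integrals, and integrability of products\<close>

lemma integral_mult_kernel_diff_eq: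
  fixes H :: "real \<Rightarrow> complex"
  assumes H: "integrable lebesgue H" and \<epsilon>: "0 < \<epsilon>"
  shows "(LINT t|lebesgue. H t * of_real (kernel_diff \<epsilon> t))
    = (LINT t|lebesgue. H t * of_real (t / (t\<^sup>2 + \<epsilon>\<^sup>2))) - (LINT t:{t. \<bar>t\<bar> \<ge> \<epsilon>}|lebesgue. H t / of_real t)"
proof -
  have Hm[measurable]: "H \<in> borel_measurable lebesgue" using H by simp
  have id: "(\<lambda>t::real. t) \<in> borel_measurable lebesgue"
    by (rule measurable_completion) simp
  \<comment> \<open>For fixed \<epsilon> both kernels are bounded by 1 / \<epsilon>, so each
    integral converges on its own and the integral of the difference may be split.\<close>
  have i1: "integrable lebesgue (\<lambda>t. H t * of_real (t / (t\<^sup>2 + \<epsilon>\<^sup>2)))"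
  proof (rule Bochner_Integration.integrable_bound)
    show "integrable lebesgue (\<lambda>t. 1 / \<epsilon> * norm (H t))"
      using H by (intro integrable_mult_right integrable_norm)
    show "(\<lambda>t. H t * of_real (t / (t\<^sup>2 + \<epsilon>\<^sup>2))) \<in> borel_measurable lebesgue"
      using id by measurable
    have "\<bar>t / (t\<^sup>2 + \<epsilon>\<^sup>2)\<bar> \<le> 1 / \<epsilon>" for t
    proof -
      \<comment> \<open>The square gives 2 * \<bar>t\<bar> * \<epsilon> \<le> t^2 + \<epsilon>^2;
        dropping one copy of the nonnegative product suffices.\<close>
      have "0 \<le> (\<bar>t\<bar> - \<epsilon>)\<^sup>2" "0 \<le> \<bar>t\<bar> * \<epsilon>" using \<epsilon> by auto
      then have "\<bar>t\<bar> * \<epsilon> \<le> t\<^sup>2 + \<epsilon>\<^sup>2"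
        unfolding power2_diff power2_abs by linarith
      moreover have "0 < t\<^sup>2 + \<epsilon>\<^sup>2" using \<epsilon> by (simp add: add_nonneg_pos)
      ultimately show ?thesis using \<epsilon> by (simp add: abs_divide divide_simps)
    qed
    then have "norm (H t) * \<bar>t / (t\<^sup>2 + \<epsilon>\<^sup>2)\<bar> \<le> norm (H t) * (1 / \<epsilon>)" for t
      by (rule mult_left_mono) simp
    then show "AE t in lebesgue. norm (H t * of_real (t / (t\<^sup>2 + \<epsilon>\<^sup>2))) \<le> norm (1 / \<epsilon> * norm (H t))"
      using \<epsilon> by (intro AE_I2) (simp add: norm_mult mult.commute del: abs_divide of_real_divide)
  qed
  have i2: "integrable lebesgue (\<lambda>t. indicator {t. \<bar>t\<bar> \<ge> \<epsilon>} t *\<^sub>R (H t / of_real t))"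
  proof (rule Bochner_Integration.integrable_bound)
    show "integrable lebesgue (\<lambda>t. 1 / \<epsilon> * norm (H t))"
      using H by (intro integrable_mult_right integrable_norm)
    have "(\<lambda>t::real. indicator {t. \<bar>t\<bar> \<ge> \<epsilon>} t :: real) \<in> borel_measurable lebesgue"
      by (rule measurable_completion) measurable
    then show "(\<lambda>t. indicator {t. \<bar>t\<bar> \<ge> \<epsilon>} t *\<^sub>R (H t / of_real t)) \<in> borel_measurable lebesgue"
      using id by measurable
    have "norm (H t) / \<bar>t\<bar> \<le> norm (H t) / \<epsilon>" if "\<epsilon> \<le> \<bar>t\<bar>" for t
      using that \<epsilon> by (intro divide_left_mono) auto
    then show "AE t in lebesgue. norm (indicator {t. \<bar>t\<bar> \<ge> \<epsilon>} t *\<^sub>R (H t / of_real t)) \<le> norm (1 / \<epsilon> * norm (H t))"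
      using \<epsilon> by (intro AE_I2) (auto simp: norm_divide indicator_def)
  qed
  have "H t * of_real (kernel_diff \<epsilon> t) = H t * of_real (t / (t\<^sup>2 + \<epsilon>\<^sup>2))
      - indicator {t. \<bar>t\<bar> \<ge> \<epsilon>} t *\<^sub>R (H t / of_real t)" for t
    by (simp add: kernel_diff_def indicator_def right_diff_distrib)
  then show ?thesis
    unfolding set_lebesgue_integral_def
    by (simp only: Bochner_Integration.integral_diff[OF i1 i2])
qed

lemma integrable_mult_conjugate:
  fixes F G :: "real \<Rightarrow> complex"
  assumes ab: "1 < a" "1 < b" "1 / a + 1 / b = 1"
    and [measurable]: "F \<in> borel_measurable M" "G \<in> borel_measurable M"
    and "integrable M (\<lambda>t. norm (F t) powr a)" "integrable M (\<lambda>t. norm (G t) powr b)"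
  shows "integrable M (\<lambda>t. F t * G t)"
proof (rule Bochner_Integration.integrable_bound)
  show "integrable M (\<lambda>t. norm (F t) powr a / a + norm (G t) powr b / b)"
    using assms by simp
  show "AE t in M. norm (F t * G t) \<le> norm (norm (F t) powr a / a + norm (G t) powr b / b)"
  proof (rule AE_I2)
    fix t
    have "norm (F t) * norm (G t) \<le> norm (F t) powr a / a + norm (G t) powr b / b"
      using ab by (intro Youngs_inequality) auto
    then show "norm (F t * G t) \<le> norm (norm (F t) powr a / a + norm (G t) powr b / b)"
      by (simp add: norm_mult)
  qed
qed measurable

theorem lemma6:
  fixes \<alpha> p\<^sub>1 p\<^sub>2 x :: real and f g :: "real \<Rightarrow> complex"
  assumes "\<alpha> \<noteq> 0" and "\<alpha> \<noteq> -1"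
    and "1 \<le> p\<^sub>1" and "1 \<le> p\<^sub>2" and "1 / p\<^sub>1 + 1 / p\<^sub>2 = 1"
    and "f \<in> Lp p\<^sub>1" and "g \<in> Lp p\<^sub>2"
    and "x \<in> lebesgue_points p\<^sub>1 f \<inter> lebesgue_points p\<^sub>2 g"
  shows "x \<in> lebesgue_points 1 (\<lambda>t. f t * g t) \<and>
    ((\<lambda>\<epsilon>. (LINT t|lebesgue. f (x - t) * g (x + \<alpha> * t) * complex_of_real (t / (t\<^sup>2 + \<epsilon>\<^sup>2)))
         - (LINT t:{t. \<bar>t\<bar> \<ge> \<epsilon>}|lebesgue. f (x - t) * g (x + \<alpha> * t) / complex_of_real t))
      \<longlongrightarrow> 0) (at_right 0)"
proof -
  \<comment> \<open>An exponent equal to 1 would force the reciprocal of the other to be 0, so both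
    are strictly larger and Young's inequality applies.\<close>
  have p: "1 < p\<^sub>1" "1 < p\<^sub>2"
    using assms(3-5) by (auto simp: less_le)
  note conj = p assms(5)
  have fm: "f \<in> borel_measurable lebesgue" and fi: "integrable lebesgue (\<lambda>t. norm (f t) powr p\<^sub>1)"
    and gm: "g \<in> borel_measurable lebesgue" and gi: "integrable lebesgue (\<lambda>t. norm (g t) powr p\<^sub>2)"
    using assms(6,7) by (auto simp: Lp_def)
  have F: "vanishing_mean p\<^sub>1 (\<lambda>t. f (x + (-1) * t) - f x)"
    using assms by (intro lebesgue_points_imp_vanishing_mean) auto
  have G: "vanishing_mean p\<^sub>2 (\<lambda>t. g (x + \<beta> * t) - g x)" if "\<beta> \<noteq> 0" for \<beta>
    using assms that by (intro lebesgue_points_imp_vanishing_mean) auto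
  \<comment> \<open>Kept general in \<beta>: the value -1 gives the product f g at the single point
    x - t, hence the Lebesgue point claim, and the value \<alpha> gives the integrand of the
    limit.\<close>
  have H: "vanishing_mean 1 (\<lambda>t. f (x - t) * g (x + \<beta> * t) - f x * g x)" if "\<beta> \<noteq> 0" for \<beta>
    using vanishing_mean_mult[OF conj F G[OF that]] by simp
  have Hi: "integrable lebesgue (\<lambda>t. f (x - t) * g (x + \<alpha> * t))"
  proof (rule integrable_mult_conjugate[OF conj])
    show "(\<lambda>t. f (x - t)) \<in> borel_measurable lebesgue" "(\<lambda>t. g (x + \<alpha> * t)) \<in> borel_measurable lebesgue"
      using measurable_lebesgue_affine[OF fm, of "-1" x] measurable_lebesgue_affine[OF gm assms(1), of x] by simp_all
    show "integrable lebesgue (\<lambda>t. norm (f (x - t)) powr p\<^sub>1)" "integrable lebesgue (\<lambda>t. norm (g (x + \<alpha> * t)) powr p\<^sub>2)"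
      using lebesgue_integrable_real_affine[OF fi, of "-1" x] lebesgue_integrable_real_affine[OF gi assms(1), of x] by simp_all
  qed
  have "integrable lebesgue (\<lambda>t. f t * g t)"
    by (rule integrable_mult_conjugate[OF conj fm gm fi gi])
  then have "(\<lambda>t. f t * g t) \<in> Lp_loc 1"
    using fm gm unfolding Lp_loc_def set_integrable_def
    by (auto simp del: real_scaleR_def intro!: integrable_mult_indicator integrable_norm
        simp: lmeasurable_compact fmeasurableD)
  then have "x \<in> lebesgue_points 1 (\<lambda>t. f t * g t)"
    using H[of "-1"] by (simp add: lebesgue_points_def vanishing_mean_def ball_mean_def[abs_def])
  moreover have "((\<lambda>\<epsilon>. (LINT t|lebesgue. f (x - t) * g (x + \<alpha> * t) * complex_of_real (t / (t\<^sup>2 + \<epsilon>\<^sup>2)))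
         - (LINT t:{t. \<bar>t\<bar> \<ge> \<epsilon>}|lebesgue. f (x - t) * g (x + \<alpha> * t) / complex_of_real t))
      \<longlongrightarrow> 0) (at_right 0)"
  proof (rule Lim_transform_eventually[OF tendsto_integral_kernel_diff[OF Hi H[OF assms(1)]]])
    \<comment> \<open>The splitting holds only for positive \<epsilon>, which is all that the
      right-hand limit sees.\<close>
    show "\<forall>\<^sub>F \<epsilon> in at_right 0. (LINT t|lebesgue. f (x - t) * g (x + \<alpha> * t) * of_real (kernel_diff \<epsilon> t))
      = (LINT t|lebesgue. f (x - t) * g (x + \<alpha> * t) * complex_of_real (t / (t\<^sup>2 + \<epsilon>\<^sup>2)))
         - (LINT t:{t. \<bar>t\<bar> \<ge> \<epsilon>}|lebesgue. f (x - t) * g (x + \<alpha> * t) / complex_of_real t)"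
      using eventually_at_right_less[of "0::real"]
      by (rule eventually_mono) (rule integral_mult_kernel_diff_eq[OF Hi])
  qed
  ultimately show ?thesis by blast
qed

end
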